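(* Let $X$ and $Y$ be infinite, locally compact, Hausdorff spaces. If $X$ is perfect and $T:C_0(X)\to C_0(Y)$ is a bijective bounded semi-wcf-homomorphism, then $T$ is multiplicative, and thus is of the form $T(f)=f\circ\psi$ ($f\in C_0(X)$) for some homeomorphism $\psi:Y\to X$.
   Context: $C_0(X)$ is the commutative $C^*$-algebra of continuous complex-valued functions on $X$ vanishing at infinity, with pointwise operations and the supremum norm. A topological space is perfect if it is non-empty and has no isolated points. For a linear map $T:A\to B$ between Banach algebras, $S_T(a,b)=T(a)T(b)-T(ab)$ ($a,b\in A$). $T$ is a semi-wcf-homomorphism if, for each $a\in A$, the linear maps $S_T(a,\cdot)$ and $S_T(\cdot,a)$ from $A$ to $B$ are weakly compact (i.e. the weak closure of the image of the open unit ball is weakly compact). *)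

theory Defs
  imports "HOL-Analysis.Analysis"
begin

section \<open>Complex Banach algebras\<close>

text \<open>The library's classes of normed spaces have real scalars only, so complex scalars are
  added on top of them, compatibly with the real ones.\<close>

class scaleC =
  fixes scaleC :: "complex \<Rightarrow> 'a \<Rightarrow> 'a"  (infixr \<open>*\<^sub>C\<close> 75)

class complex_normed_vector = scaleC + real_normed_vector +
  assumes scaleC_add_right: "a *\<^sub>C (x + y) = a *\<^sub>C x + a *\<^sub>C y"
    and scaleC_add_left: "(a + b) *\<^sub>C x = a *\<^sub>C x + b *\<^sub>C x"
    and scaleC_scaleC: "a *\<^sub>C b *\<^sub>C x = (a * b) *\<^sub>C x"
    and scaleC_of_real: "complex_of_real r *\<^sub>C x = r *\<^sub>R x"
    and norm_scaleC: "norm (a *\<^sub>C x) = cmod a * norm x"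

class complex_banach_algebra = complex_normed_vector + real_normed_algebra + banach +
  assumes mult_scaleC_left: "(a *\<^sub>C x) * y = a *\<^sub>C (x * y)"
    and mult_scaleC_right: "x * (a *\<^sub>C y) = a *\<^sub>C (x * y)"

instantiation complex :: complex_banach_algebra
begin

definition scaleC_complex :: "complex \<Rightarrow> complex \<Rightarrow> complex"
  where "scaleC_complex a x = a * x"

instance
  by standard (auto simp: scaleC_complex_def algebra_simps norm_mult scaleR_conv_of_real)

end

definition clinear :: "('a::complex_normed_vector \<Rightarrow> 'b::complex_normed_vector) \<Rightarrow> bool"
  where "clinear T \<longleftrightarrow>
    (\<forall>x y. T (x + y) = T x + T y) \<and> (\<forall>c x. T (c *\<^sub>C x) = c *\<^sub>C T x)"

definition bounded_clinear :: "('a::complex_normed_vector \<Rightarrow> 'b::complex_normed_vector) \<Rightarrow> bool"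
  where "bounded_clinear T \<longleftrightarrow> clinear T \<and> (\<exists>K. \<forall>x. norm (T x) \<le> K * norm x)"


section \<open>Weak compactness and semi-wcf-homomorphisms\<close>

definition weak_topology :: "'a::complex_normed_vector topology"
  where "weak_topology =
    topology_generated_by {\<phi> -` U |(\<phi> :: 'a \<Rightarrow> complex) U. bounded_clinear \<phi> \<and> open U}"

definition weakly_compact_map ::
    "('a::complex_normed_vector \<Rightarrow> 'b::complex_normed_vector) \<Rightarrow> bool"
  where "weakly_compact_map T \<longleftrightarrow>
    clinear T \<and> compactin weak_topology (weak_topology closure_of (T ` ball 0 1))"

definition mult_defect ::
    "('a::complex_banach_algebra \<Rightarrow> 'b::complex_banach_algebra) \<Rightarrow> 'a \<Rightarrow> 'a \<Rightarrow> 'b"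
  where "mult_defect T a b = T a * T b - T (a * b)"

definition semi_wcf_homomorphism ::
    "('a::complex_banach_algebra \<Rightarrow> 'b::complex_banach_algebra) \<Rightarrow> bool"
  where "semi_wcf_homomorphism T \<longleftrightarrow> clinear T \<and>
    (\<forall>a. weakly_compact_map (\<lambda>b. mult_defect T a b) \<and>
         weakly_compact_map (\<lambda>b. mult_defect T b a))"


section \<open>The algebra of continuous functions vanishing at infinity\<close>

definition vanishes_at_infinity :: "('a::topological_space \<Rightarrow> complex) \<Rightarrow> bool"
  where "vanishes_at_infinity f \<longleftrightarrow> (\<forall>e>0. compact {x. e \<le> cmod (f x)})"

typedef (overloaded) 'a c0 =
  "{f :: 'a::topological_space \<Rightarrow> complex. continuous_on UNIV f \<and> vanishes_at_infinity f}"
  morphisms apply_c0 Abs_c0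
proof -
  have "(\<lambda>_. 0) \<in> {f :: 'a \<Rightarrow> complex. continuous_on UNIV f \<and> vanishes_at_infinity f}"
    by (auto simp: vanishes_at_infinity_def not_le)
  then show ?thesis by blast
qed

setup_lifting type_definition_c0

lemma continuous_on_apply_c0 [continuous_intros]: "continuous_on A (apply_c0 f)"
  using apply_c0[of f] continuous_on_subset by blast

lemma vanishes_at_infinity_apply_c0: "vanishes_at_infinity (apply_c0 f)"
  using apply_c0[of f] by blast

lemma c0_eqI: "(\<And>x. apply_c0 f x = apply_c0 g x) \<Longrightarrow> f = g"
  by (simp add: apply_c0_inject[symmetric] ext)

lemma compact_superlevel:
  fixes f :: "'a::topological_space \<Rightarrow> complex"
  assumes f: "continuous_on UNIV f" and K: "compact K" and sub: "{x. e \<le> cmod (f x)} \<subseteq> K"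
  shows "compact {x. e \<le> cmod (f x)}"
proof -
  have "closed {x. e \<le> cmod (f x)}"
    by (intro closed_Collect_le continuous_intros f)
  then have "compact (K \<inter> {x. e \<le> cmod (f x)})"
    using K by (rule compact_Int_closed[rotated])
  then show ?thesis using sub by (simp add: Int_absorb1)
qed

lemma vanishes_at_infinity_add:
  fixes f g :: "'a::topological_space \<Rightarrow> complex"
  assumes "continuous_on UNIV f" "continuous_on UNIV g"
    and "vanishes_at_infinity f" "vanishes_at_infinity g"
  shows "vanishes_at_infinity (\<lambda>x. f x + g x)"
  unfolding vanishes_at_infinity_def
proof (intro allI impI)
  fix e :: real assume e: "e > 0"
  have K: "compact ({x. e/2 \<le> cmod (f x)} \<union> {x. e/2 \<le> cmod (g x)})"
    using assms(3,4) e unfolding vanishes_at_infinity_def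
    by (intro compact_Un) (meson half_gt_zero)+
  show "compact {x. e \<le> cmod (f x + g x)}"
  proof (rule compact_superlevel[OF _ K])
    show "continuous_on UNIV (\<lambda>x. f x + g x)" by (intro continuous_intros assms)
    show "{x. e \<le> cmod (f x + g x)} \<subseteq> {x. e/2 \<le> cmod (f x)} \<union> {x. e/2 \<le> cmod (g x)}"
    proof
      fix x assume "x \<in> {x. e \<le> cmod (f x + g x)}"
      then have "e \<le> cmod (f x) + cmod (g x)"
        using norm_triangle_ineq[of "f x" "g x"] by simp
      then show "x \<in> {x. e/2 \<le> cmod (f x)} \<union> {x. e/2 \<le> cmod (g x)}"
        by (simp, linarith)
    qed
  qed
qed

lemma vanishes_at_infinity_bdd_mult:
  fixes f g :: "'a::topological_space \<Rightarrow> complex"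
  assumes "continuous_on UNIV f" "continuous_on UNIV g" "vanishes_at_infinity g"
    and B: "\<And>x. cmod (f x) \<le> B"
  shows "vanishes_at_infinity (\<lambda>x. f x * g x)"
  unfolding vanishes_at_infinity_def
proof (intro allI impI)
  fix e :: real assume e: "e > 0"
  define C where "C = max B 1"
  have C: "C > 0" "\<And>x. cmod (f x) \<le> C" using B by (auto simp: C_def le_max_iff_disj)
  have K: "compact {x. e/C \<le> cmod (g x)}"
    using assms e C by (auto simp: vanishes_at_infinity_def)
  show "compact {x. e \<le> cmod (f x * g x)}"
  proof (rule compact_superlevel[OF _ K])
    show "continuous_on UNIV (\<lambda>x. f x * g x)" by (intro continuous_intros assms)
    show "{x. e \<le> cmod (f x * g x)} \<subseteq> {x. e/C \<le> cmod (g x)}"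
    proof
      fix x assume "x \<in> {x. e \<le> cmod (f x * g x)}"
      then have "e \<le> C * cmod (g x)"
        using mult_right_mono[OF C(2)[of x], of "cmod (g x)"] by (simp add: norm_mult)
      then show "x \<in> {x. e/C \<le> cmod (g x)}"
        using C by (simp add: divide_le_eq mult.commute)
    qed
  qed
qed

lemma bounded_range_apply_c0: "bounded (range (apply_c0 f))"
proof -
  let ?K = "{x. 1 \<le> cmod (apply_c0 f x)}"
  have "compact ?K"
    using vanishes_at_infinity_apply_c0[of f] by (simp add: vanishes_at_infinity_def)
  then have "bounded (apply_c0 f ` ?K)"
    by (intro compact_imp_bounded compact_continuous_image continuous_on_apply_c0)
  moreover have "bounded (apply_c0 f ` (- ?K))"
    by (rule boundedI[of _ 1]) auto
  ultimately have "bounded (apply_c0 f ` ?K \<union> apply_c0 f ` (- ?K))"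
    by (rule bounded_Un[THEN iffD2, OF conjI])
  then show ?thesis by (rule bounded_subset) blast
qed

instantiation c0 :: (topological_space) complex_normed_vector
begin

lift_definition zero_c0 :: "'a c0" is "\<lambda>_. 0"
  by (auto simp: vanishes_at_infinity_def not_le)

lift_definition plus_c0 :: "'a c0 \<Rightarrow> 'a c0 \<Rightarrow> 'a c0" is "\<lambda>f g x. f x + g x"
  by (auto intro!: continuous_intros vanishes_at_infinity_add)

lift_definition uminus_c0 :: "'a c0 \<Rightarrow> 'a c0" is "\<lambda>f x. - f x"
  by (auto intro!: continuous_intros simp: vanishes_at_infinity_def)

definition minus_c0 :: "'a c0 \<Rightarrow> 'a c0 \<Rightarrow> 'a c0" where "minus_c0 f g = f + - g"

lift_definition scaleC_c0 :: "complex \<Rightarrow> 'a c0 \<Rightarrow> 'a c0" is "\<lambda>c f x. c * f x"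
  by (auto intro!: continuous_intros vanishes_at_infinity_bdd_mult[where B = "cmod _"])

definition scaleR_c0 :: "real \<Rightarrow> 'a c0 \<Rightarrow> 'a c0" where "scaleR_c0 r f = complex_of_real r *\<^sub>C f"

definition norm_c0 :: "'a c0 \<Rightarrow> real" where "norm_c0 f = (SUP x. cmod (apply_c0 f x))"

definition sgn_c0 :: "'a c0 \<Rightarrow> 'a c0" where "sgn_c0 f = inverse (norm f) *\<^sub>R f"

definition dist_c0 :: "'a c0 \<Rightarrow> 'a c0 \<Rightarrow> real" where "dist_c0 f g = norm (f - g)"

definition uniformity_c0 :: "('a c0 \<times> 'a c0) filter"
  where "uniformity_c0 = (INF e\<in>{0<..}. principal {(f, g). dist f g < e})"

definition open_c0 :: "'a c0 set \<Rightarrow> bool"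
  where "open_c0 U \<longleftrightarrow> (\<forall>f\<in>U. \<forall>\<^sub>F (f', g) in uniformity. f' = f \<longrightarrow> g \<in> U)"

lemma apply_minus_c0: "apply_c0 (f - g) x = apply_c0 f x - apply_c0 g x"
  by (simp add: minus_c0_def plus_c0.rep_eq uminus_c0.rep_eq)

lemma apply_scaleR_c0: "apply_c0 (r *\<^sub>R f) x = r *\<^sub>R apply_c0 f x"
  by (simp add: scaleR_c0_def scaleC_c0.rep_eq scaleR_conv_of_real)

lemmas apply_c0_simps = zero_c0.rep_eq plus_c0.rep_eq uminus_c0.rep_eq apply_minus_c0
  scaleC_c0.rep_eq apply_scaleR_c0

lemma cmod_apply_le_norm_c0: "cmod (apply_c0 f x) \<le> norm f"
  unfolding norm_c0_def
proof (rule cSUP_upper)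
  show "bdd_above (range (\<lambda>x. cmod (apply_c0 f x)))"
    using bounded_range_apply_c0[of f] by (auto simp: bounded_iff bdd_above_def)
qed simp

lemma norm_c0_leI: "(\<And>x. cmod (apply_c0 f x) \<le> B) \<Longrightarrow> norm f \<le> B"
  unfolding norm_c0_def by (rule cSUP_least) auto

lemma norm_scaleC_c0: "norm (c *\<^sub>C (f :: 'a c0)) = cmod c * norm f"
proof (rule antisym)
  have le: "norm (c *\<^sub>C f) \<le> cmod c * norm f" for c and f :: "'a c0"
    by (rule norm_c0_leI)
      (simp add: apply_c0_simps norm_mult mult_left_mono cmod_apply_le_norm_c0)
  show "norm (c *\<^sub>C f) \<le> cmod c * norm f" by (rule le)
  show "cmod c * norm f \<le> norm (c *\<^sub>C f)"
  proof (cases "c = 0")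
    case True
    then show ?thesis
      using order_trans[OF norm_ge_zero cmod_apply_le_norm_c0[of "c *\<^sub>C f"]] by simp
  next
    case False
    have "inverse c *\<^sub>C c *\<^sub>C f = f"
      using False by (intro c0_eqI) (simp add: apply_c0_simps)
    then show ?thesis
      using le[of "inverse c" "c *\<^sub>C f"] False by (simp add: norm_inverse norm_divide field_simps)
  qed
qed

instance
proof
  fix f g h :: "'a c0" and a b :: real and c d :: complex and U :: "'a c0 set"
  show "f + g + h = f + (g + h)" "f + g = g + f" "0 + f = f" "- f + f = 0" "f - g = f + - g"
    "a *\<^sub>R (f + g) = a *\<^sub>R f + a *\<^sub>R g" "(a + b) *\<^sub>R f = a *\<^sub>R f + b *\<^sub>R f"
    "a *\<^sub>R b *\<^sub>R f = (a * b) *\<^sub>R f" "1 *\<^sub>R f = f"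
    "c *\<^sub>C (f + g) = c *\<^sub>C f + c *\<^sub>C g" "(c + d) *\<^sub>C f = c *\<^sub>C f + d *\<^sub>C f"
    "c *\<^sub>C d *\<^sub>C f = (c * d) *\<^sub>C f"
    by (auto intro!: c0_eqI simp: apply_c0_simps algebra_simps scaleR_conv_of_real)
  show "complex_of_real a *\<^sub>C f = a *\<^sub>R f" by (simp add: scaleR_c0_def)
  show "norm (c *\<^sub>C f) = cmod c * norm f" by (rule norm_scaleC_c0)
  show "norm (a *\<^sub>R f) = \<bar>a\<bar> * norm f" by (simp add: scaleR_c0_def norm_scaleC_c0)
  show "norm (f + g) \<le> norm f + norm g"
    by (rule norm_c0_leI)
      (auto simp: apply_c0_simps intro: norm_triangle_le add_mono cmod_apply_le_norm_c0)
  show "norm f = 0 \<longleftrightarrow> f = 0"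
  proof
    assume "norm f = 0"
    then show "f = 0"
      using cmod_apply_le_norm_c0[of f] by (intro c0_eqI) (simp add: apply_c0_simps)
  next
    assume "f = 0"
    then show "norm f = 0" by (simp add: norm_c0_def apply_c0_simps)
  qed
  show "sgn f = inverse (norm f) *\<^sub>R f" by (rule sgn_c0_def)
  show "dist f g = norm (f - g)" by (rule dist_c0_def)
  show "(uniformity :: ('a c0 \<times> 'a c0) filter) = (INF e\<in>{0<..}. principal {(f, g). dist f g < e})"
    by (rule uniformity_c0_def)
  show "open U \<longleftrightarrow> (\<forall>f\<in>U. \<forall>\<^sub>F (f', g) in uniformity. f' = f \<longrightarrow> g \<in> U)"
    by (rule open_c0_def)
qed

end

instance c0 :: (topological_space) banach
proof
  fix F :: "nat \<Rightarrow> 'a c0"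
  assume "Cauchy F"
  then have C: "\<exists>M. \<forall>m\<ge>M. \<forall>n\<ge>M. norm (F m - F n) < e" if "e > 0" for e
    using that by (auto simp: Cauchy_def dist_c0_def)
  have "uniformly_Cauchy_on UNIV (\<lambda>n. apply_c0 (F n))"
    unfolding uniformly_Cauchy_on_def
  proof (intro allI impI)
    fix e :: real assume "e > 0"
    then obtain M where "\<forall>m\<ge>M. \<forall>n\<ge>M. norm (F m - F n) < e" using C by blast
    then show "\<exists>M. \<forall>x\<in>UNIV. \<forall>m\<ge>M. \<forall>n\<ge>M. dist (apply_c0 (F m) x) (apply_c0 (F n) x) < e"
      by (metis apply_minus_c0 cmod_apply_le_norm_c0 dist_norm le_less_trans)
  qed
  then obtain f where f: "uniform_limit UNIV (\<lambda>n. apply_c0 (F n)) f sequentially"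
    using Cauchy_uniformly_convergent uniformly_convergent_on_def by blast
  have cont: "continuous_on UNIV f"
    by (rule uniform_limit_theorem[OF _ f]) (auto intro!: always_eventually continuous_on_apply_c0)
  have near: "\<exists>M. \<forall>n\<ge>M. \<forall>x. cmod (apply_c0 (F n) x - f x) < e" if "e > 0" for e
    using f that by (auto simp: uniform_limit_sequentially_iff dist_norm)
  have "vanishes_at_infinity f"
    unfolding vanishes_at_infinity_def
  proof (intro allI impI)
    fix e :: real assume "e > 0"
    then obtain n where n: "\<And>x. cmod (apply_c0 (F n) x - f x) < e/2"
      using near[of "e/2"] by auto
    have K: "compact {x. e/2 \<le> cmod (apply_c0 (F n) x)}"
      using vanishes_at_infinity_apply_c0[of "F n"] \<open>e > 0\<close>
      unfolding vanishes_at_infinity_def by (meson half_gt_zero)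
    show "compact {x. e \<le> cmod (f x)}"
    proof (rule compact_superlevel[OF cont K], safe)
      fix x assume "e \<le> cmod (f x)"
      then show "e/2 \<le> cmod (apply_c0 (F n) x)"
        using n[of x] norm_triangle_ineq2[of "f x" "apply_c0 (F n) x"]
        by (simp add: norm_minus_commute)
    qed
  qed
  with cont have app: "apply_c0 (Abs_c0 f) = f" by (simp add: Abs_c0_inverse)
  have "F \<longlonglongrightarrow> Abs_c0 f"
  proof (rule metric_LIMSEQ_I)
    fix e :: real assume "e > 0"
    then obtain M where M: "\<forall>n\<ge>M. \<forall>x. cmod (apply_c0 (F n) x - f x) < e/2"
      using near[of "e/2"] by auto
    have "dist (F n) (Abs_c0 f) < e" if "n \<ge> M" for n
    proof -
      have "norm (F n - Abs_c0 f) \<le> e/2"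
        using M that by (intro norm_c0_leI) (auto simp: apply_minus_c0 app intro: less_imp_le)
      then show ?thesis using \<open>e > 0\<close> by (simp add: dist_c0_def)
    qed
    then show "\<exists>M. \<forall>n\<ge>M. dist (F n) (Abs_c0 f) < e" by blast
  qed
  then show "convergent F" by (auto simp: convergent_def)
qed

instantiation c0 :: (topological_space) complex_banach_algebra
begin

lift_definition times_c0 :: "'a c0 \<Rightarrow> 'a c0 \<Rightarrow> 'a c0" is "\<lambda>f g x. f x * g x"
proof -
  fix f g :: "'a \<Rightarrow> complex"
  assume f: "continuous_on UNIV f \<and> vanishes_at_infinity f"
    and g: "continuous_on UNIV g \<and> vanishes_at_infinity g"
  obtain B where "\<And>x. cmod (f x) \<le> B"
    using bounded_range_apply_c0[of "Abs_c0 f"] f by (auto simp: Abs_c0_inverse bounded_iff)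
  then show "continuous_on UNIV (\<lambda>x. f x * g x) \<and> vanishes_at_infinity (\<lambda>x. f x * g x)"
    using f g by (auto intro!: continuous_intros vanishes_at_infinity_bdd_mult)
qed

instance
proof
  fix f g h :: "'a c0" and a :: real and c :: complex
  show "f * g * h = f * (g * h)" "(f + g) * h = f * h + g * h" "f * (g + h) = f * g + f * h"
    "(a *\<^sub>R f) * g = a *\<^sub>R (f * g)" "f * (a *\<^sub>R g) = a *\<^sub>R (f * g)"
    "(c *\<^sub>C f) * g = c *\<^sub>C (f * g)" "f * (c *\<^sub>C g) = c *\<^sub>C (f * g)"
    by (auto intro!: c0_eqI simp: apply_c0_simps times_c0.rep_eq algebra_simps)
  show "norm (f * g) \<le> norm f * norm g"
    by (rule norm_c0_leI) (auto simp: times_c0.rep_eq norm_mult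
        intro!: mult_mono cmod_apply_le_norm_c0 order_trans[OF norm_ge_zero cmod_apply_le_norm_c0])
qed

end

end

theory Submission
  imports Defs
begin

text \<open>Let \<open>b\<close> be a bump function of height 1/2 at \<open>x\<close> with small support. As \<open>g * b\<close> is close to
  \<open>g x *\<^sub>C b\<close>, the defect \<open>mult_defect T g b\<close> is close to \<open>(T g - g x) * T b\<close>. If no evaluation
  functional at a point \<open>y\<close> satisfied \<open>T f y = f x\<close> for all \<open>f\<close>, then dividing by the functions
  \<open>T g - g x\<close> would produce from the defects a relatively weakly compact map sending such \<open>b\<close> close
  to \<open>b\<close>. The bump functions would then have a weak cluster point, which is half the indicator
  function of \<open>x\<close>; hence \<open>x\<close> would be isolated. So every \<open>x\<close> has a point \<open>\<theta> x\<close> with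
  \<open>T f (\<theta> x) = f x\<close>. A function \<open>T d\<close> vanishing on the range of \<open>\<theta>\<close> has \<open>d = 0\<close>; applied to
  \<open>T (f * g) - T f * T g\<close> this gives multiplicativity, and \<open>\<psi>\<close> is the inverse of \<open>\<theta>\<close>.\<close>

section \<open>Bounded complex-linear maps and boundedness of inverses\<close>

lemma bounded_clinear_imp_bounded_linear:
  assumes "bounded_clinear T"
  shows "bounded_linear T"
proof -
  obtain K where "\<And>x. norm (T x) \<le> K * norm x" "clinear T"
    using assms by (auto simp: bounded_clinear_def)
  then show ?thesis
    unfolding clinear_def
    by (intro bounded_linear_intro[where K = K]) (simp_all add: mult.commute flip: scaleC_of_real)
qed

lemma bounded_clinearI:
  assumes "bounded_linear T" "\<And>c x. T (c *\<^sub>C x) = c *\<^sub>C T x"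
  shows "bounded_clinear T"
  using assms bounded_linear.bounded[OF assms(1)]
  by (auto simp: bounded_clinear_def clinear_def linear_add bounded_linear.linear mult.commute)

lemma bounded_clinear_scaleC: "bounded_clinear T \<Longrightarrow> T (c *\<^sub>C x) = c *\<^sub>C T x"
  by (simp add: bounded_clinear_def clinear_def)

lemma bounded_clinear_compose:
  "bounded_clinear S \<Longrightarrow> bounded_clinear T \<Longrightarrow> bounded_clinear (\<lambda>x. S (T x))"
  by (intro bounded_clinearI)
    (auto simp: bounded_clinear_scaleC intro: bounded_linear_compose
      bounded_clinear_imp_bounded_linear)

text \<open>Baire's theorem makes the image of some ball dense in a ball around 0, and successive
  approximation then solves \<open>T a = b\<close> with control of the norm of \<open>a\<close>.\<close>
theorem bounded_linear_inv_banach: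
  fixes T :: "'a::banach \<Rightarrow> 'b::banach"
  assumes T: "bounded_linear T" and "bij T"
  shows "bounded_linear (inv T)"
proof -
  interpret T: bounded_linear T by (rule T)
  have inv_T [simp]: "inv T (T a) = a" "T (inv T b) = b" for a b
    using \<open>bij T\<close> by (simp_all add: bij_is_inj bij_is_surj surj_f_inv_f)
  define C where "C n = closure (T ` cball 0 (real n))" for n
  have "\<exists>n. interior (C n) \<noteq> {}"
  proof (rule ccontr)
    assume "\<nexists>n. interior (C n) \<noteq> {}"
    then have "euclidean interior_of \<Union>(range C) = {}"
      by (intro Baire_category_alt)
        (auto simp: C_def completely_metrizable_space_euclidean interior_of_def interior_def)
    moreover have "b \<in> \<Union>(range C)" for b
    proof -
      obtain n where "norm (inv T b) \<le> real n" using real_arch_simple by blast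
      then have "b \<in> T ` cball 0 (real n)" by (intro image_eqI[of _ _ "inv T b"]) auto
      then have "b \<in> C n" unfolding C_def by (rule subsetD[OF closure_subset])
      then show ?thesis by blast
    qed
    then have "\<Union>(range C) = UNIV" by blast
    ultimately show False by (metis UNIV_not_empty interior_of_topspace topspace_euclidean)
  qed
  then obtain n b r where r: "r > 0" and ball: "ball b r \<subseteq> C n"
    by (metis ex_in_conv mem_interior)
  have approx: "\<exists>a. norm a \<le> (2 * real n / r) * norm v \<and> norm (v - T a) \<le> norm v / 2" for v
  proof (cases "v = 0")
    case False
    \<comment> \<open>The factor \<open>s\<close> shrinks \<open>v\<close> to length
      \<open>r / 2\<close>, so that both \<open>b + s *\<^sub>R v\<close> and
      \<open>b - s *\<^sub>R v\<close> lie in the ball. Subtracting their approximate preimages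
      cancels the centre \<open>b\<close>; the two errors add up to \<open>s * norm v\<close>, and
      dividing by \<open>2 * s\<close> leaves \<open>norm v / 2\<close>.\<close>
    define s where "s = r / (2 * norm v)"
    have s: "s > 0" "norm (s *\<^sub>R v) = r / 2" using False r by (auto simp: s_def)
    have "b + s *\<^sub>R v \<in> C n" "b - s *\<^sub>R v \<in> C n"
      using ball r s by (auto simp: dist_norm subset_iff)
    moreover have "\<exists>p. norm p \<le> n \<and> dist (T p) z < s * norm v / 2" if "z \<in> C n" for z
    proof -
      have "s * norm v / 2 > 0" using False s by simp
      then obtain p where "p \<in> cball 0 (real n)" "dist (T p) z < s * norm v / 2"
        using \<open>z \<in> C n\<close> unfolding C_def closure_approachable by blast
      then show ?thesis by auto
    qed
    ultimately obtain p q where pq: "norm p \<le> n" "norm q \<le> n"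
      "dist (T p) (b + s *\<^sub>R v) < s * norm v / 2" "dist (T q) (b - s *\<^sub>R v) < s * norm v / 2"
      by blast
    define a where "a = (1 / (2 * s)) *\<^sub>R (p - q)"
    have "norm (p - q) \<le> 2 * n" using norm_triangle_ineq4[of p q] pq by simp
    then have "norm a \<le> (1 / (2 * s)) * (2 * n)"
      unfolding a_def using s by (simp only: norm_scaleR) (intro mult_mono, auto)
    also have "\<dots> = (2 * real n / r) * norm v" using s r False by (simp add: s_def)
    finally have 1: "norm a \<le> (2 * real n / r) * norm v" .
    have "(2 * s) *\<^sub>R (v - T a) = ((b + s *\<^sub>R v) - T p) - ((b - s *\<^sub>R v) - T q)"
      using s by (simp add: a_def T.scaleR T.diff algebra_simps flip: scaleR_add_left)
    then have "norm ((2 * s) *\<^sub>R (v - T a)) \<le> s * norm v"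
      using pq norm_triangle_ineq4[of "(b + s *\<^sub>R v) - T p" "(b - s *\<^sub>R v) - T q"]
      by (simp add: dist_norm norm_minus_commute)
    then have "norm (v - T a) \<le> norm v / 2" using s by (simp add: mult.commute)
    with 1 show ?thesis by blast
  qed (auto intro: exI[of _ 0])
  define M where "M = 2 * real n / r"
  obtain A where A: "\<And>v. norm (A v) \<le> M * norm v" "\<And>v. norm (v - T (A v)) \<le> norm v / 2"
    using approx unfolding M_def by metis
  have M: "M \<ge> 0" using r by (simp add: M_def)
  have "norm (inv T v) \<le> norm v * (2 * M)" for v
  proof -
    \<comment> \<open>\<open>u k\<close> is what remains of \<open>v\<close> after \<open>k\<close>
      corrections. Its norm bound halves each time, so a geometric series dominates the corrections
      \<open>A (u k)\<close>, and their images telescope to \<open>v - u m\<close>.\<close>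
    define u where "u k = ((\<lambda>v. v - T (A v)) ^^ k) v" for k
    have u: "norm (u k) \<le> norm v * (1/2) ^ k" for k
    proof (induction k)
      case (Suc k)
      have "norm (u (Suc k)) \<le> norm (u k) / 2" using A(2) by (simp add: u_def)
      with Suc show ?case by simp
    qed (simp add: u_def)
    have Au: "norm (A (u k)) \<le> M * norm v * (1/2) ^ k" for k
      using A(1)[of "u k"] mult_left_mono[OF u[of k] M] by (simp add: mult.assoc)
    have geo: "(\<lambda>k. M * norm v * (1/2) ^ k) sums (M * norm v * 2)"
      using geometric_sums[of "1/2 :: real"] by (intro sums_mult) auto
    then have sm: "summable (\<lambda>k. norm (A (u k)))"
      by (intro summable_comparison_test'[OF sums_summable[OF geo]]) (use Au in auto)
    have "(\<lambda>m. v - u m) \<longlonglongrightarrow> v - 0"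
      by (intro tendsto_intros Lim_null_comparison[OF always_eventually[OF allI[OF u]]])
        (auto intro!: tendsto_mult_right_zero LIMSEQ_power_zero)
    moreover have "(\<Sum>k<m. T (A (u k))) = v - u m" for m
      by (induction m) (auto simp: u_def)
    ultimately have sums_v: "(\<lambda>k. T (A (u k))) sums v" by (simp add: sums_def)
    have sums_T: "(\<lambda>k. T (A (u k))) sums T (\<Sum>k. A (u k))"
      by (rule T.sums[OF summable_sums[OF summable_norm_cancel[OF sm]]])
    have "v = T (\<Sum>k. A (u k))" by (rule sums_unique2[OF sums_v sums_T])
    then have "inv T v = (\<Sum>k. A (u k))" by (simp only: inv_T(1))
    moreover have "norm (\<Sum>k. A (u k)) \<le> M * norm v * 2"
      by (rule order_trans[OF summable_norm[OF sm]])
        (metis suminf_le[OF Au sm sums_summable[OF geo]] sums_unique[OF geo])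
    ultimately show ?thesis by (simp add: algebra_simps)
  qed
  then show ?thesis
    by (rule bounded_linear_intro[rotated 2]) (metis T.add T.scaleR inv_T)+
qed

lemma bounded_clinear_inv:
  fixes T :: "'a::complex_banach_algebra \<Rightarrow> 'b::complex_banach_algebra"
  assumes "bounded_clinear T" "bij T"
  shows "bounded_clinear (inv T)"
proof (rule bounded_clinearI)
  show "bounded_linear (inv T)"
    using assms by (intro bounded_linear_inv_banach bounded_clinear_imp_bounded_linear)
  show "inv T (c *\<^sub>C x) = c *\<^sub>C inv T x" for c x
    by (rule inv_f_eq[OF bij_is_inj[OF assms(2)]])
      (simp add: bounded_clinear_scaleC[OF assms(1)] surj_f_inv_f[OF bij_is_surj[OF assms(2)]])
qed


section \<open>Relatively weakly compact maps\<close>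

lemma topspace_weak_topology [simp]: "topspace weak_topology = UNIV"
proof -
  have "bounded_clinear (\<lambda>_::'a. 0::complex)"
    by (auto simp: bounded_clinear_def clinear_def scaleC_complex_def intro: exI[of _ 0])
  then have "(\<lambda>_. 0::complex) -` UNIV \<in>
      {\<phi> -` U |(\<phi> :: 'a \<Rightarrow> complex) U. bounded_clinear \<phi> \<and> open U}" by blast
  then show ?thesis unfolding weak_topology_def topology_generated_by_topspace by auto
qed

lemma continuous_map_weak_functional:
  "bounded_clinear \<phi> \<Longrightarrow> continuous_map weak_topology euclidean (\<phi> :: _ \<Rightarrow> complex)"
  unfolding continuous_map_alt topspace_weak_topology Int_UNIV_right
  by (auto simp: weak_topology_def intro!: topology_generated_by_Basis)

text \<open>The weak topology is the initial topology of the bounded functionals, so continuity can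
  be tested on each of them. This yields weak continuity of bounded linear maps and of
  addition.\<close>

lemma continuous_map_into_weak:
  assumes "\<And>\<phi> :: 'b::complex_normed_vector \<Rightarrow> complex.
    bounded_clinear \<phi> \<Longrightarrow> continuous_map X euclidean (\<lambda>x. \<phi> (f x))"
  shows "continuous_map X weak_topology f"
proof -
  have "(\<Union>{\<phi> -` U |(\<phi> :: 'b \<Rightarrow> complex) U. bounded_clinear \<phi> \<and> open U}) = UNIV"
    using topspace_weak_topology[where 'a = 'b]
    unfolding weak_topology_def topology_generated_by_topspace .
  then show ?thesis
    unfolding weak_topology_def continuous_on_generated_topo_iff
    using assms by (auto simp: continuous_map_alt vimage_def)
qed

text \<open>With some weakly compact superset in place of a compact closure, compositions and sums
  reduce to continuous images of compact sets.\<close>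

definition rel_weakly_compact ::
    "('a::complex_normed_vector \<Rightarrow> 'b::complex_normed_vector) \<Rightarrow> bool"
  where "rel_weakly_compact S \<longleftrightarrow> (\<exists>K. compactin weak_topology K \<and> S ` ball 0 1 \<subseteq> K)"

lemma weakly_compact_map_imp_rel_weakly_compact:
  "weakly_compact_map S \<Longrightarrow> rel_weakly_compact S"
  unfolding weakly_compact_map_def rel_weakly_compact_def
  by (metis closure_of_subset subset_UNIV topspace_weak_topology)

lemma rel_weakly_compact_compose:
  assumes "rel_weakly_compact S" "bounded_clinear L"
  shows "rel_weakly_compact (\<lambda>b. L (S b))"
proof -
  have "continuous_map weak_topology weak_topology L"
    by (rule continuous_map_into_weak)
      (rule continuous_map_weak_functional[OF bounded_clinear_compose[OF _ assms(2)]])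
  moreover obtain K where "compactin weak_topology K" "S ` ball 0 1 \<subseteq> K"
    using assms(1) by (auto simp: rel_weakly_compact_def)
  ultimately show ?thesis
    unfolding rel_weakly_compact_def by (intro exI[of _ "L ` K"]) (auto intro: image_compactin)
qed

lemma rel_weakly_compact_add:
  assumes "rel_weakly_compact S" "rel_weakly_compact R"
  shows "rel_weakly_compact (\<lambda>b. S b + R b)"
proof -
  obtain K L where K: "compactin weak_topology K" "S ` ball 0 1 \<subseteq> K"
    and L: "compactin weak_topology L" "R ` ball 0 1 \<subseteq> L"
    using assms by (auto simp: rel_weakly_compact_def)
  \<comment> \<open>Addition is jointly weakly continuous because a functional splits over it; hence
    the sum set of \<open>K\<close> and \<open>L\<close> is the image of a compact product.\<close>
  have "continuous_map (prod_topology weak_topology weak_topology) weak_topology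
      (\<lambda>p. fst p + snd p :: 'b)"
  proof (rule continuous_map_into_weak)
    fix \<phi> :: "'b \<Rightarrow> complex"
    assume \<phi>: "bounded_clinear \<phi>"
    have "continuous_map (prod_topology weak_topology weak_topology) euclidean
        (\<lambda>p. \<phi> (fst p) + \<phi> (snd p))"
      using continuous_map_compose[OF continuous_map_fst continuous_map_weak_functional[OF \<phi>]]
        continuous_map_compose[OF continuous_map_snd continuous_map_weak_functional[OF \<phi>]]
      by (intro continuous_map_add) (auto simp: o_def)
    then show "continuous_map (prod_topology weak_topology weak_topology) euclidean
        (\<lambda>p. \<phi> (fst p + snd p))"
      using \<phi> by (simp add: bounded_clinear_def clinear_def)
  qed
  then have "compactin weak_topology ((\<lambda>p. fst p + snd p) ` (K \<times> L))"
    using K L by (intro image_compactin) (auto simp: compactin_Times)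
  moreover have "(\<lambda>b. S b + R b) ` ball 0 1 \<subseteq> (\<lambda>p. fst p + snd p) ` (K \<times> L)"
    using K L by force
  ultimately show ?thesis unfolding rel_weakly_compact_def by blast
qed

lemma rel_weakly_compact_sum:
  assumes "finite I" "\<And>i. i \<in> I \<Longrightarrow> rel_weakly_compact (S i)"
  shows "rel_weakly_compact (\<lambda>b. \<Sum>i\<in>I. S i b)"
  using assms
proof (induction I rule: finite_induct)
  case empty
  have "compactin weak_topology {0}" by (simp add: finite_imp_compactin)
  then show ?case unfolding rel_weakly_compact_def by (intro exI[of _ "{0}"]) auto
next
  case (insert i I)
  then show ?case by (simp add: rel_weakly_compact_add)
qed


section \<open>Evaluations, multipliers and bump functions\<close>

lemma bounded_clinear_apply_c0: "bounded_clinear (\<lambda>f. apply_c0 f x)"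
  by (auto simp: bounded_clinear_def clinear_def apply_c0_simps scaleC_complex_def
      intro!: exI[of _ 1] cmod_apply_le_norm_c0)

lemma compact_superlevel_c0: "e > 0 \<Longrightarrow> compact {x. e \<le> cmod (apply_c0 f x)}"
  using vanishes_at_infinity_apply_c0[of f] by (simp add: vanishes_at_infinity_def)

text \<open>The factor \<open>w\<close> may be any bounded continuous function; it need not vanish
  at infinity. For other \<open>w\<close> the product may lie outside the type, whence the
  hypotheses of the next lemmas.\<close>

definition multiplier :: "('a::topological_space \<Rightarrow> complex) \<Rightarrow> 'a c0 \<Rightarrow> 'a c0"
  where "multiplier w f = Abs_c0 (\<lambda>x. w x * apply_c0 f x)"

lemma apply_multiplier:
  assumes "continuous_on UNIV w" "\<And>x. cmod (w x) \<le> B"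
  shows "apply_c0 (multiplier w f) x = w x * apply_c0 f x"
  unfolding multiplier_def using assms
  by (subst Abs_c0_inverse) (auto intro!: continuous_intros vanishes_at_infinity_bdd_mult
      vanishes_at_infinity_apply_c0)

lemma bounded_clinear_multiplier:
  assumes "continuous_on UNIV w" "\<And>x. cmod (w x) \<le> B"
  shows "bounded_clinear (multiplier w)"
proof -
  note [simp] = apply_multiplier[OF assms] apply_c0_simps
  have "norm (multiplier w f) \<le> B * norm f" for f
    using order_trans[OF norm_ge_zero assms(2)]
    by (intro norm_c0_leI) (auto simp: norm_mult intro!: mult_mono assms cmod_apply_le_norm_c0)
  moreover have "clinear (multiplier w)"
    unfolding clinear_def by (intro conjI allI c0_eqI) (auto simp: algebra_simps)
  ultimately show ?thesis by (auto simp: bounded_clinear_def)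
qed

text \<open>A locally compact Hausdorff space is completely regular. Shrinking \<open>U\<close> to
  its intersection with a neighbourhood inside a compact set makes the separating function vanish at
  infinity.\<close>

lemma c0_bump:
  fixes x :: "'a::t2_space"
  assumes "locally_compact_space (euclidean :: 'a topology)" "open U" "x \<in> U"
  obtains f :: "'a c0" where "apply_c0 f x = 1" "\<And>z. cmod (apply_c0 f z) \<le> 1"
    "\<And>z. z \<notin> U \<Longrightarrow> apply_c0 f z = 0"
proof -
  obtain V K where V: "open V" "compact K" "x \<in> V" "V \<subseteq> K"
    using assms(1)[unfolded locally_compact_space_def, rule_format, of x] by auto
  have "Hausdorff_space (euclidean :: 'a topology)"
    unfolding Hausdorff_space_def disjnt_def open_openin[symmetric] by (blast dest: hausdorff)
  then have "completely_regular_space (euclidean :: 'a topology)"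
    using assms(1) by (intro locally_compact_regular_imp_completely_regular_space) auto
  moreover have "closedin euclidean (- (U \<inter> V))" "x \<in> topspace euclidean - (- (U \<inter> V))"
    using V assms by auto
  ultimately obtain h :: "'a \<Rightarrow> real" where h: "continuous_map euclidean (top_of_set {0..1}) h"
    "h x = 0" "h ` (- (U \<inter> V)) \<subseteq> {1}"
    unfolding completely_regular_space_def by blast
  have cont: "continuous_on UNIV h" and range: "\<And>z. h z \<in> {0..1}"
    using h(1) by (auto simp: continuous_map_in_subtopology)
  define b where "b z = complex_of_real (1 - h z)" for z
  have b: "continuous_on UNIV b" unfolding b_def by (intro continuous_intros cont)
  have "b z = 0" if "z \<notin> U \<inter> V" for z using h(3) that by (auto simp: b_def)
  then have "{z. e \<le> cmod (b z)} \<subseteq> K" if "e > 0" for e using that V by force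
  then have "vanishes_at_infinity b"
    unfolding vanishes_at_infinity_def using compact_superlevel[OF b V(2)] by blast
  then have app: "apply_c0 (Abs_c0 b) = b" using b by (simp add: Abs_c0_inverse)
  show thesis
  proof (rule that[of "Abs_c0 b"])
    show "cmod (apply_c0 (Abs_c0 b) z) \<le> 1" for z
      using range[of z] unfolding app b_def norm_of_real by auto
  qed (use h in \<open>auto simp: app b_def\<close>)
qed


section \<open>Evaluation points\<close>

text \<open>A weak cluster point of the images of bump functions shrinking to \<open>x\<close> is a multiple of the
  indicator function of \<open>x\<close>, so that the latter is continuous.\<close>
lemma open_singleton_if_rel_weakly_compact:
  fixes x :: "'a::t2_space" and Q :: "'a c0 \<Rightarrow> 'a c0"
  assumes lc: "locally_compact_space (euclidean :: 'a topology)"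
    and Q: "rel_weakly_compact Q"
    and near: "\<And>e. e > 0 \<Longrightarrow> \<exists>U. open U \<and> x \<in> U \<and>
      (\<forall>b. norm b \<le> 1 \<longrightarrow> (\<forall>z. z \<notin> U \<longrightarrow> apply_c0 b z = 0) \<longrightarrow> norm (Q b - b) \<le> e)"
  shows "open {x}"
proof -
  obtain K where K: "compactin weak_topology K" "Q ` ball 0 1 \<subseteq> K"
    using Q by (auto simp: rel_weakly_compact_def)
  \<comment> \<open>The height 1/2 keeps the bumps in the open unit ball, so that \<open>Q\<close>
    maps them into \<open>K\<close>.\<close>
  define B where "B U = {b. apply_c0 b x = 1/2 \<and> norm b \<le> 1/2 \<and> (\<forall>z. z \<notin> U \<longrightarrow> apply_c0 b z = 0)}" for U
  have B_ne: "B U \<noteq> {}" if U: "open U" "x \<in> U" for U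
  proof -
    obtain f :: "'a c0" where f: "apply_c0 f x = 1" "\<And>z. cmod (apply_c0 f z) \<le> 1"
      "\<And>z. z \<notin> U \<Longrightarrow> apply_c0 f z = 0"
      using c0_bump[OF lc U] by blast
    have "norm f \<le> 1" by (rule norm_c0_leI) (rule f)
    then have "(1/2) *\<^sub>C f \<in> B U" using f by (auto simp: B_def apply_c0_simps norm_scaleC)
    then show ?thesis by blast
  qed
  \<comment> \<open>A cluster point exists by compactness: otherwise finitely many
    \<open>W k\<close> cover \<open>K\<close>, and a bump living in the intersection of the matching
    \<open>U k\<close> has its image in none of them.\<close>
  have "\<exists>k\<in>K. \<forall>W U. openin weak_topology W \<and> k \<in> W \<and> open U \<and> x \<in> U \<longrightarrow> (\<exists>b\<in>B U. Q b \<in> W)"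
  proof (rule ccontr)
    assume "\<not> ?thesis"
    then have "\<forall>k\<in>K. \<exists>W U. openin weak_topology W \<and> k \<in> W \<and> open U \<and> x \<in> U \<and> (\<forall>b\<in>B U. Q b \<notin> W)"
      by simp
    then obtain W U where WU: "\<And>k. k \<in> K \<Longrightarrow> openin weak_topology (W k)"
      "\<And>k. k \<in> K \<Longrightarrow> k \<in> W k" "\<And>k. k \<in> K \<Longrightarrow> open (U k)" "\<And>k. k \<in> K \<Longrightarrow> x \<in> U k"
      "\<And>k b. k \<in> K \<Longrightarrow> b \<in> B (U k) \<Longrightarrow> Q b \<notin> W k"
      by metis
    have "\<exists>F. finite F \<and> F \<subseteq> W ` K \<and> K \<subseteq> \<Union>F"
      using WU(1,2) by (intro compactinD[OF K(1)]) auto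
    then obtain I where I: "finite I" "I \<subseteq> K" "K \<subseteq> \<Union>(W ` I)"
      by (metis finite_subset_image)
    have "open (\<Inter>k\<in>I. U k)" using I WU(3) by (intro open_INT) auto
    moreover have "x \<in> (\<Inter>k\<in>I. U k)" using I WU(4) by blast
    ultimately obtain b where b: "b \<in> B (\<Inter>k\<in>I. U k)" using B_ne by blast
    then have "Q b \<in> K" using K(2) by (auto simp: B_def)
    then obtain k where k: "k \<in> I" "Q b \<in> W k" using I by blast
    moreover have "b \<in> B (U k)" using b k(1) by (auto simp: B_def)
    ultimately show False using WU(5) I by blast
  qed
  then obtain k where k: "\<And>W U. \<lbrakk>openin weak_topology W; k \<in> W; open U; x \<in> U\<rbrakk>
      \<Longrightarrow> \<exists>b\<in>B U. Q b \<in> W" by blast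
  \<comment> \<open>Evaluation at \<open>z\<close> gives a weak neighbourhood of \<open>k\<close>.
    Since \<open>Q b\<close> is uniformly close to \<open>b\<close> for small supports, the bumps
    themselves, not only their images, approach \<open>k\<close> at \<open>z\<close>.\<close>
  have close: "\<exists>b\<in>B U. cmod (apply_c0 b z - apply_c0 k z) \<le> e"
    if U: "open U" "x \<in> U" and e: "e > 0" for U z e
  proof -
    obtain V where V: "open V" "x \<in> V" "\<And>b. \<lbrakk>norm b \<le> 1; \<And>z. z \<notin> V \<Longrightarrow> apply_c0 b z = 0\<rbrakk>
        \<Longrightarrow> norm (Q b - b) \<le> e/2"
      using near[of "e/2"] e by auto
    have "openin weak_topology ((\<lambda>f. apply_c0 f z) -` ball (apply_c0 k z) (e/2))"
      using continuous_map_weak_functional[OF bounded_clinear_apply_c0, of z]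
      by (simp add: continuous_map_alt)
    then obtain b where b: "b \<in> B (U \<inter> V)" "cmod (apply_c0 (Q b) z - apply_c0 k z) < e/2"
      using k[of "(\<lambda>f. apply_c0 f z) -` ball (apply_c0 k z) (e/2)" "U \<inter> V"] U V e
      by (auto simp: dist_norm norm_minus_commute)
    have "cmod (apply_c0 (Q b - b) z) \<le> e/2"
      using V(3)[of b] b(1) by (intro order_trans[OF cmod_apply_le_norm_c0]) (auto simp: B_def)
    then have "cmod (apply_c0 b z - apply_c0 k z) \<le> e"
      using b(2) norm_triangle_ineq4[of "apply_c0 (Q b) z - apply_c0 k z" "apply_c0 (Q b - b) z"]
      by (simp add: apply_c0_simps)
    moreover have "b \<in> B U" using b by (auto simp: B_def)
    ultimately show ?thesis by blast
  qed
  have kx: "apply_c0 k x = 1/2"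
  proof -
    have "cmod (1/2 - apply_c0 k x) \<le> 0 + e" if "e > 0" for e
    proof -
      obtain b where "b \<in> B UNIV" "cmod (apply_c0 b x - apply_c0 k x) \<le> e"
        using close[OF open_UNIV UNIV_I \<open>e > 0\<close>] by blast
      moreover from this(1) have "apply_c0 b x = 1/2" unfolding B_def by blast
      ultimately show ?thesis by simp
    qed
    from field_le_epsilon[OF this] show ?thesis by simp
  qed
  have kz: "apply_c0 k z = 0" if "z \<noteq> x" for z
  proof -
    have "cmod (apply_c0 k z) \<le> 0 + e" if "e > 0" for e
      \<comment> \<open>Bumps supported in the neighbourhood \<open>- {z}\<close> of
        \<open>x\<close> vanish at \<open>z\<close>.\<close>
      using close[of "- {z}" e z] \<open>z \<noteq> x\<close> that by (auto simp: B_def open_Compl)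
    from field_le_epsilon[OF this] show ?thesis by simp
  qed
  have "{x} = {z. apply_c0 k z \<noteq> 0}" using kx kz by force
  also have "open \<dots>" by (intro open_Collect_neq continuous_intros)
  finally show ?thesis .
qed

lemma apply_c0_sum: "apply_c0 (\<Sum>i\<in>I. f i) x = (\<Sum>i\<in>I. apply_c0 (f i) x)"
  using bounded_clinear_imp_bounded_linear[OF bounded_clinear_apply_c0]
  by (rule linear_sum[OF bounded_linear.linear])

text \<open>Without such a point the functions \<open>h g\<close> have no common zero, so finitely
  many of them satisfy an identity \<open>\<Sum> w g * h g = 1\<close> with bounded coefficients,
  which allows division.\<close>

lemma ex_evaluation_point:
  fixes T :: "'x::t2_space c0 \<Rightarrow> 'y::t2_space c0"
  assumes lc: "locally_compact_space (euclidean :: 'x topology)"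
    and T: "bij T" "bounded_clinear T" "semi_wcf_homomorphism T"
    and x: "\<not> open {x}"
  shows "\<exists>y. \<forall>f. apply_c0 (T f) y = apply_c0 f x"
proof (rule ccontr)
  assume none: "\<nexists>y. \<forall>f. apply_c0 (T f) y = apply_c0 f x"
  define h where "h g y = apply_c0 (T g) y - apply_c0 g x" for g y
  have h_cont [continuous_intros]: "continuous_on A (h g)" for A g
    unfolding h_def by (intro continuous_intros)
  have h_bd: "cmod (h g y) \<le> norm (T g) + norm g" for g y
    unfolding h_def
    by (intro order_trans[OF norm_triangle_ineq4] add_mono cmod_apply_le_norm_c0)
  obtain g0 :: "'x c0" where g0: "apply_c0 g0 x = 1"
    using c0_bump[OF lc open_UNIV UNIV_I] by blast
  \<comment> \<open>Off \<open>K\<close> the function \<open>h g0\<close> has modulus at least 1/2,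
    since \<open>g0\<close> is 1 at \<open>x\<close>. Thus \<open>g0\<close> alone controls the
    region near infinity, and compactness is called for only on \<open>K\<close>.\<close>
  define K where "K = {y. 1/2 \<le> cmod (apply_c0 (T g0) y)}"
  have K: "compact K"
    unfolding K_def by (rule compact_superlevel_c0) simp
  have "K \<subseteq> (\<Union>g\<in>UNIV. {y. h g y \<noteq> 0})" using none by (auto simp: h_def)
  then obtain G' where G': "finite G'" "K \<subseteq> (\<Union>g\<in>G'. {y. h g y \<noteq> 0})"
    by (rule compactE_image[OF K, rotated]) (intro open_Collect_neq continuous_intros | blast)+
  define G where "G = insert g0 G'"
  have G: "finite G" "g0 \<in> G" using G' by (auto simp: G_def)
  define H where "H y = (\<Sum>g\<in>G. (cmod (h g y))\<^sup>2)" for y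
  have H_cont [continuous_intros]: "continuous_on A H" for A
    unfolding H_def by (intro continuous_intros)
  have H_out: "1/4 \<le> H y" if "y \<notin> K" for y
  proof -
    have "1/2 \<le> cmod (h g0 y)"
      using that norm_triangle_ineq2[of 1 "apply_c0 (T g0) y"] g0
      by (simp add: K_def h_def norm_minus_commute)
    then have "(1/2)\<^sup>2 \<le> (cmod (h g0 y))\<^sup>2" by (intro power_mono) auto
    also have "\<dots> \<le> H y" unfolding H_def using G by (intro member_le_sum) auto
    finally show ?thesis by (simp add: power2_eq_square)
  qed
  have H_in: "H y > 0" if "y \<in> K" for y
  proof -
    obtain g where g: "g \<in> G" "h g y \<noteq> 0" using G'(2) \<open>y \<in> K\<close> unfolding G_def by blast
    show ?thesis unfolding H_def by (rule sum_pos2[OF G(1) g(1)]) (use g(2) in auto)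
  qed
  \<comment> \<open>A uniform lower bound: 1/4 off \<open>K\<close>, and the minimum attained on
    \<open>K\<close> if \<open>K\<close> is nonempty.\<close>
  obtain c where c: "c > 0" "\<And>y. c \<le> H y"
  proof (cases "K = {}")
    case True
    then show thesis using that[of "1/4"] H_out by auto
  next
    case False
    then obtain y0 where y0: "y0 \<in> K" "\<And>y. y \<in> K \<Longrightarrow> H y0 \<le> H y"
      using continuous_attains_inf[OF K _ H_cont] by blast
    have "min (1/4) (H y0) \<le> H y" for y
      using H_out[of y] y0(2)[of y] by (cases "y \<in> K") (simp_all add: min_le_iff_disj)
    moreover have "0 < min (1/4) (H y0)" using H_in y0(1) by simp
    ultimately show thesis using that by blast
  qed
  \<comment> \<open>As \<open>H\<close> is the sum of the \<open>h g * cnj (h g)\<close>, these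
    coefficients solve the identity; the bound \<open>c\<close> keeps them bounded.\<close>
  define w where "w g y = cnj (h g y) / complex_of_real (H y)" for g y
  have H0: "H y \<noteq> 0" for y using c(1) c(2)[of y] by linarith
  have w: "continuous_on UNIV (w g)" "cmod (w g y) \<le> (norm (T g) + norm g) / c" for g y
  proof -
    show "continuous_on UNIV (w g)" unfolding w_def using H0 by (intro continuous_intros) auto
    have "cmod (w g y) = cmod (h g y) / H y"
      using c(1) c(2)[of y] by (simp add: w_def norm_divide)
    also have "\<dots> \<le> (norm (T g) + norm g) / c" using c h_bd by (intro frac_le) auto
    finally show "cmod (w g y) \<le> (norm (T g) + norm g) / c" .
  qed
  have w_sum: "(\<Sum>g\<in>G. w g y * h g y) = 1" for y
  proof -
    have "w g y * h g y = complex_of_real ((cmod (h g y))\<^sup>2) / complex_of_real (H y)" for g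
      unfolding w_def complex_norm_square by (simp add: mult.commute)
    then have "(\<Sum>g\<in>G. w g y * h g y) =
        (\<Sum>g\<in>G. complex_of_real ((cmod (h g y))\<^sup>2)) / complex_of_real (H y)"
      by (simp only: sum_divide_distrib)
    also have "(\<Sum>g\<in>G. complex_of_real ((cmod (h g y))\<^sup>2)) = complex_of_real (H y)"
      unfolding H_def by (rule of_real_sum[symmetric])
    finally show ?thesis using H0 by simp
  qed
  note app_w = apply_multiplier[OF w]
  define L where "L g f = inv T (multiplier (w g) f)" for g f
  have L: "bounded_clinear (L g)" for g
    unfolding L_def
    by (rule bounded_clinear_compose[OF bounded_clinear_inv[OF T(2,1)]
          bounded_clinear_multiplier[OF w]])
  note lin = bounded_linear.linear[OF bounded_clinear_imp_bounded_linear]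
  define Q where "Q b = (\<Sum>g\<in>G. L g (mult_defect T g b))" for b
  have "rel_weakly_compact (\<lambda>b. mult_defect T g b)" for g
    using T(3) by (simp add: semi_wcf_homomorphism_def weakly_compact_map_imp_rel_weakly_compact)
  then have "rel_weakly_compact (\<lambda>b. L g (mult_defect T g b))" for g
    using L by (rule rel_weakly_compact_compose)
  then have Q: "rel_weakly_compact Q"
    unfolding Q_def using G(1) by (intro rel_weakly_compact_sum)
  \<comment> \<open>The identity recovers \<open>b\<close> from the products
    \<open>(T g - g x) * T b\<close>. Each differs from the defect only by \<open>T\<close> of
    \<open>g x *\<^sub>C b - g * b\<close>, which is small for \<open>b\<close> concentrated near
    \<open>x\<close>.\<close>
  have Q_diff: "Q b - b = (\<Sum>g\<in>G. L g (T (apply_c0 g x *\<^sub>C b - g * b)))" for b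
  proof -
    have "T b = (\<Sum>g\<in>G. multiplier (w g) (T g * T b - apply_c0 g x *\<^sub>C T b))"
    proof (rule c0_eqI)
      fix y
      have "(\<Sum>g\<in>G. w g y * h g y) * apply_c0 (T b) y =
          apply_c0 (\<Sum>g\<in>G. multiplier (w g) (T g * T b - apply_c0 g x *\<^sub>C T b)) y"
        unfolding sum_distrib_right apply_c0_sum app_w apply_c0_simps times_c0.rep_eq h_def
        by (intro sum.cong refl) (simp add: algebra_simps)
      then show "apply_c0 (T b) y = \<dots>" by (simp add: w_sum)
    qed
    then have "b = inv T (\<Sum>g\<in>G. multiplier (w g) (T g * T b - apply_c0 g x *\<^sub>C T b))"
      by (intro inv_f_eq[OF bij_is_inj[OF T(1)], symmetric])
    also have "\<dots> = (\<Sum>g\<in>G. L g (T g * T b - apply_c0 g x *\<^sub>C T b))"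
      unfolding L_def by (rule linear_sum[OF lin[OF bounded_clinear_inv[OF T(2,1)]]])
    finally have "Q b - b =
        (\<Sum>g\<in>G. L g (mult_defect T g b - (T g * T b - apply_c0 g x *\<^sub>C T b)))"
      by (simp add: Q_def sum_subtractf linear_diff[OF lin[OF L]])
    moreover have "mult_defect T g b - (T g * T b - apply_c0 g x *\<^sub>C T b) =
        T (apply_c0 g x *\<^sub>C b - g * b)" for g
      by (simp add: mult_defect_def linear_diff[OF lin[OF T(2)]] bounded_clinear_scaleC[OF T(2)])
    ultimately show ?thesis by (simp only:)
  qed
  have "\<exists>C. \<forall>f. norm (L g (T f)) \<le> C * norm f" for g
    using bounded_clinear_compose[OF L T(2)] unfolding bounded_clinear_def by blast
  then obtain C where C: "\<And>g f. norm (L g (T f)) \<le> C g * norm f" by metis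
  have "\<exists>U. open U \<and> x \<in> U \<and>
      (\<forall>b. norm b \<le> 1 \<longrightarrow> (\<forall>z. z \<notin> U \<longrightarrow> apply_c0 b z = 0) \<longrightarrow> norm (Q b - b) \<le> e)"
    if e: "e > 0" for e
  proof -
    \<comment> \<open>The absolute values and the added 1 make \<open>S\<close> positive whatever
      the \<open>C g\<close> are. On \<open>U\<close> each of the finitely many \<open>g\<close>
      differs from its value at \<open>x\<close> by less than \<open>e / S\<close>.\<close>
    define S where "S = (\<Sum>g\<in>G. \<bar>C g\<bar>) + 1"
    have S: "S > 0" unfolding S_def by (intro add_nonneg_pos sum_nonneg) auto
    define U where "U = (\<Inter>g\<in>G. {z. cmod (apply_c0 g x - apply_c0 g z) < e / S})"
    have "open U" unfolding U_def using G
      by (intro open_INT ballI open_Collect_less continuous_intros) auto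
    moreover have "x \<in> U" using e S by (simp add: U_def)
    moreover have "norm (Q b - b) \<le> e"
      if b: "norm b \<le> 1" "\<And>z. z \<notin> U \<Longrightarrow> apply_c0 b z = 0" for b
    proof -
      have 1: "norm (apply_c0 g x *\<^sub>C b - g * b) \<le> e / S" if "g \<in> G" for g
      proof (rule norm_c0_leI)
        fix z
        have "apply_c0 (apply_c0 g x *\<^sub>C b - g * b) z =
            (apply_c0 g x - apply_c0 g z) * apply_c0 b z"
          by (simp add: apply_c0_simps times_c0.rep_eq algebra_simps)
        moreover have "cmod ((apply_c0 g x - apply_c0 g z) * apply_c0 b z) \<le> e / S"
        proof (cases "z \<in> U")
          case True
          then have "cmod (apply_c0 g x - apply_c0 g z) \<le> e / S"
            using that by (auto simp: U_def intro: less_imp_le)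
          moreover have "cmod (apply_c0 b z) \<le> 1"
            using cmod_apply_le_norm_c0 b(1) by (rule order_trans)
          ultimately show ?thesis
            using mult_mono[of _ "e / S" _ 1] e S by (simp add: norm_mult)
        qed (use b(2) e S in simp)
        ultimately show "cmod (apply_c0 (apply_c0 g x *\<^sub>C b - g * b) z) \<le> e / S" by simp
      qed
      have "norm (Q b - b) \<le> (\<Sum>g\<in>G. norm (L g (T (apply_c0 g x *\<^sub>C b - g * b))))"
        unfolding Q_diff by (rule norm_sum)
      also have "\<dots> \<le> (\<Sum>g\<in>G. \<bar>C g\<bar> * (e / S))"
        using 1 by (intro sum_mono order_trans[OF C] mult_mono) auto
      also have "\<dots> \<le> S * (e / S)"
        using e S unfolding sum_distrib_right[symmetric]
        by (intro mult_right_mono) (auto simp: S_def)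
      finally show ?thesis using S by simp
    qed
    ultimately show ?thesis by blast
  qed
  then have "open {x}" by (rule open_singleton_if_rel_weakly_compact[OF lc Q])
  with x show False by blast
qed

section \<open>Multiplicativity and the homeomorphism\<close>

theorem theorem4p4:
  fixes T :: "'x::{t2_space, perfect_space} c0 \<Rightarrow> 'y::t2_space c0"
  assumes "locally_compact_space (euclidean :: 'x topology)"
    and "locally_compact_space (euclidean :: 'y topology)"
    and "infinite (UNIV :: 'x set)"
    and "infinite (UNIV :: 'y set)"
    and "bij T"
    and "bounded_clinear T"
    and "semi_wcf_homomorphism T"
  shows "(\<forall>f g. T (f * g) = T f * T g) \<and>
    (\<exists>\<psi> :: 'y \<Rightarrow> 'x. homeomorphic_map euclidean euclidean \<psi> \<and>
      (\<forall>f. apply_c0 (T f) = apply_c0 f \<circ> \<psi>))"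
proof -
  note lcX = assms(1) and lcY = assms(2) and T = assms(5-7)
  obtain \<theta> where \<theta>: "\<And>x f. apply_c0 (T f) (\<theta> x) = apply_c0 f x"
    using ex_evaluation_point[OF lcX T not_open_singleton] by metis
  have zero: "D = 0" if "\<And>x. apply_c0 D (\<theta> x) = 0" for D
  proof -
    obtain d where d: "D = T d" using T(1) by (meson bij_pointE)
    have "d = 0" using that d by (intro c0_eqI) (simp add: \<theta> zero_c0.rep_eq)
    then show ?thesis
      using d linear_0[OF bounded_linear.linear[OF bounded_clinear_imp_bounded_linear[OF T(2)]]]
      by simp
  qed
  have mult: "T (f * g) = T f * T g" for f g
    using zero[of "T (f * g) - T f * T g"] by (simp add: \<theta> times_c0.rep_eq apply_c0_simps)
  have "inj \<theta>"
  proof (rule injI, rule ccontr)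
    fix x z assume eq: "\<theta> x = \<theta> z" and "x \<noteq> z"
    then obtain f :: "'x c0" where "apply_c0 f x = 1" "apply_c0 f z = 0"
      by (auto intro: c0_bump[OF lcX, of "- {z}" x])
    then show False using \<theta>[of f x] \<theta>[of f z] eq by simp
  qed
  have \<theta>_cont: "continuous_on UNIV \<theta>"
  proof (rule continuous_on_open_vimage[THEN iffD2, rule_format, OF open_UNIV])
    fix V :: "'y set" assume V: "open V"
    show "open (\<theta> -` V \<inter> UNIV)"
    proof (subst open_subopen, intro ballI)
      fix x assume "x \<in> \<theta> -` V \<inter> UNIV"
      then obtain k :: "'y c0" where k: "apply_c0 k (\<theta> x) = 1"
        "\<And>y. y \<notin> V \<Longrightarrow> apply_c0 k y = 0"
        by (auto intro: c0_bump[OF lcY V, of "\<theta> x"])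
      \<comment> \<open>The preimage \<open>f\<close> is the composition of the bump
        \<open>k\<close> with \<theta>, so its nonvanishing set is an open neighbourhood of
        \<open>x\<close> that \<theta> maps into \<open>V\<close>.\<close>
      obtain f where "k = T f" using T(1) by (meson bij_pointE)
      then have "apply_c0 k (\<theta> z) = apply_c0 f z" for z by (simp add: \<theta>)
      then show "\<exists>U. open U \<and> x \<in> U \<and> U \<subseteq> \<theta> -` V \<inter> UNIV"
        using k by (intro exI[of _ "{z. apply_c0 f z \<noteq> 0}"])
          (force intro!: open_Collect_neq continuous_intros)
    qed
  qed
  text \<open>The image of \<open>\<theta>\<close> is dense by \<open>zero\<close>, and it is closed since it meets the compact superlevel
    sets of \<open>T f\<close> in the images of those of \<open>f\<close>.\<close>
  have "surj \<theta>"
  proof (rule ccontr)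
    assume "\<not> surj \<theta>"
    then obtain y where y: "y \<notin> range \<theta>" by blast
    obtain k :: "'y c0" where k: "apply_c0 k y = 1"
      using c0_bump[OF lcY open_UNIV UNIV_I] by blast
    obtain f where f: "k = T f" using T(1) by (meson bij_pointE)
    define C where "C = {x. 1/2 \<le> cmod (apply_c0 f x)}"
    have "compact C"
      unfolding C_def by (rule compact_superlevel_c0) simp
    then have "compact (\<theta> ` C)"
      by (intro compact_continuous_image continuous_on_subset[OF \<theta>_cont]) auto
    then have "open (- (\<theta> ` C))" by (simp add: compact_imp_closed open_Compl)
    moreover have "open {y. 1/2 < cmod (apply_c0 k y)}"
      by (intro open_Collect_less continuous_intros)
    ultimately have "open (- (\<theta> ` C) \<inter> {y. 1/2 < cmod (apply_c0 k y)})" by (rule open_Int)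
    moreover have "y \<in> - (\<theta> ` C) \<inter> {y. 1/2 < cmod (apply_c0 k y)}" using y k by auto
    ultimately obtain D :: "'y c0" where D: "apply_c0 D y = 1"
      "\<And>v. v \<notin> - (\<theta> ` C) \<inter> {y. 1/2 < cmod (apply_c0 k y)} \<Longrightarrow> apply_c0 D v = 0"
      by (rule c0_bump[OF lcY]) blast
    \<comment> \<open>For \<open>x\<close> in \<open>C\<close> the point \<open>\<theta> x\<close>
      lies in the removed set; for other \<open>x\<close> the modulus of
      \<open>k (\<theta> x) = f x\<close> is below 1/2. Either way \<open>D\<close> vanishes
      there.\<close>
    have "D = 0" by (intro zero D(2)) (auto simp: C_def f \<theta>)
    then show False using D(1) by (simp add: zero_c0.rep_eq)
  qed
  define \<psi> where "\<psi> = inv \<theta>"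
  have \<psi>: "\<psi> (\<theta> x) = x" "\<theta> (\<psi> y) = y" for x y
    using \<open>inj \<theta>\<close> \<open>surj \<theta>\<close> by (simp_all add: \<psi>_def surj_f_inv_f)
  have T_eq: "apply_c0 (T f) = apply_c0 f \<circ> \<psi>" for f
    using \<theta>[of f "\<psi> _"] by (auto simp: \<psi>)
  have "continuous_on UNIV \<psi>"
  proof (rule continuous_on_open_vimage[THEN iffD2, rule_format, OF open_UNIV])
    fix U :: "'x set" assume U: "open U"
    show "open (\<psi> -` U \<inter> UNIV)"
    proof (subst open_subopen, intro ballI)
      fix y assume "y \<in> \<psi> -` U \<inter> UNIV"
      then obtain f :: "'x c0" where f: "apply_c0 f (\<psi> y) = 1"
        "\<And>x. x \<notin> U \<Longrightarrow> apply_c0 f x = 0"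
        by (auto intro: c0_bump[OF lcX U, of "\<psi> y"])
      \<comment> \<open>Since \<open>T f\<close> is \<open>f\<close> composed with \<psi>, it is
        nonzero at \<open>y\<close> and only at points that \<psi> maps into
        \<open>U\<close>.\<close>
      then show "\<exists>V. open V \<and> y \<in> V \<and> V \<subseteq> \<psi> -` U \<inter> UNIV"
        by (intro exI[of _ "{z. apply_c0 (T f) z \<noteq> 0}"] conjI open_Collect_neq continuous_intros)
          (auto simp: T_eq)
    qed
  qed
  then have "homeomorphic_maps euclidean euclidean \<psi> \<theta>"
    using \<theta>_cont by (simp add: homeomorphic_maps_def \<psi>)
  then have "homeomorphic_map euclidean euclidean \<psi>" by (rule homeomorphic_maps_imp_map)
  then show ?thesis using mult T_eq by blast
qed

end
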